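(* Let $n\ge 2$, $q=p^m$ with $p$ prime and $m\ge1$, $T$ a basis of $\mathbb{F}_q$ over $\mathbb{F}_p$, and $\widehat{I}\subseteq\Delta_n$ a closed set with set of covering relations $I$. Let $U=UT_{\widehat{I}}(n,\mathbb{F}_q)$, with parabolic subgroups $U_K$ ($K\subseteq I$) and Borel subgroup $B=U_I$. The following are equivalent: (1) $U$ has the intersection property for the partition $P=\{S_{(i,j)}\mid (i,j)\in I\}$, where $S_{(i,j)}=\{e_{i,j}(t)\mid t\in T\}$; (2) for all $K\subseteq I$, $U_K=\langle e_{i,j}(t)\mid t\in T,\ (i,j)\in I\setminus K\rangle$; (3) for all $(i,j)\in\widehat{I}$, $|C_{(i,j)}|=1$; (4) $B=\langle\mathbf{1}\rangle$.
   Context: $\Delta_n=\{(a,b)\in\mathbb{N}^2\mid 1\le a<b\le n\}$. A subset $S\subseteq\Delta_n$ is closed if $(i,j),(j,k)\in S$ implies $(i,k)\in S$. A closed set $\widehat{I}$ defines a strict partial order on $\{1,\dots,n\}$ by $i\prec j$ iff $(i,j)\in\widehat{I}$; its set of covering relations is $I=\{(i,j)\in\widehat{I}\mid \text{there is no }k\text{ with } i\prec k\prec j\}$. A chain is a sequence $(c_1,\dots,c_l)$ of elements of $\{1,\dots,n\}$ with each consecutive pair $(c_k,c_{k+1})\in I$; it is an $(i,j)$-chain if $c_1=i$ and $c_l=j$; $C_{(i,j)}$ is the set of all $(i,j)$-chains. For $(i,j)\in\Delta_n$ and $t\in\mathbb{F}_q$, $e_{i,j}(t)$ is the $n\times n$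 upper unitriangular matrix over $\mathbb{F}_q$ with $(i,j)$-entry $t$ and all other off-diagonal entries $0$. The pattern group is $UT_{\widehat{I}}(n,\mathbb{F}_q)=\{g\in UT(n,\mathbb{F}_q)\mid g_{i,j}=0\text{ for all }(i,j)\in\Delta_n\setminus\widehat{I}\}$, where $UT(n,\mathbb{F}_q)$ is the group of upper unitriangular matrices. For $(i,j)\in I$, $U_{(i,j)}:=\langle e_{k,l}(t)\mid t\in T,\ (k,l)\in I\setminus\{(i,j)\}\rangle$; for $K\subseteq I$, $U_K:=\bigcap_{(i,j)\in K}U_{(i,j)}$ with $U_\emptyset=U$; $B:=U_I$. The set $\{e_{i,j}(t)\mid t\in T,(i,j)\in I\}$ generates $U$. Intersection property for a partition: if $G=\langle S\rangle$ with $S$ finite and $P=\{S_i\mid i\in I\}$ is a disjoint partition of $S$, then $G$ has the intersection property for $P$ if for all $J,K\subseteq I$, $\langle \bigcup_{j\in J}S_j\rangle\cap\langle\bigcup_{j\in K}S_j\rangle=\langle\bigcup_{j\in J\cap K}S_j\rangle$. *)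

theory Defs
  imports
    "HOL-Algebra.Generated_Groups"
    "HOL-Library.Disjoint_Sets"
    "Jordan_Normal_Form.Gauss_Jordan_Elimination"
begin

definition prime_subfield :: "'a::field set" where
  "prime_subfield = range of_int"

(* The scalars form a subfield F of the field under consideration, so the type-based
   vector space locale does not apply. *)
definition basis_over :: "'a::{field,finite} set \<Rightarrow> 'a set \<Rightarrow> bool" where
  "basis_over F T \<longleftrightarrow>
     (\<forall>c \<in> T \<rightarrow> F. (\<Sum>t\<in>T. c t * t) = 0 \<longrightarrow> (\<forall>t\<in>T. c t = 0)) \<and>
     (\<forall>x. \<exists>c \<in> T \<rightarrow> F. x = (\<Sum>t\<in>T. c t * t))"

definition Delta :: "nat \<Rightarrow> (nat \<times> nat) set" where
  "Delta n = {(a, b). 1 \<le> a \<and> a < b \<and> b \<le> n}"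

definition covers :: "(nat \<times> nat) set \<Rightarrow> (nat \<times> nat) set" where
  "covers R = {(i, j) \<in> R. \<not> (\<exists>k. (i, k) \<in> R \<and> (k, j) \<in> R)}"

(* R is the strict order; the steps of a chain are covering relations of R. *)
definition cover_chains :: "nat \<Rightarrow> (nat \<times> nat) set \<Rightarrow> nat \<Rightarrow> nat \<Rightarrow> nat list set" where
  "cover_chains n R i j =
     {c. c \<noteq> [] \<and> set c \<subseteq> {1..n} \<and> successively (\<lambda>a b. (a, b) \<in> covers R) c \<and>
         hd c = i \<and> last c = j}"

(* Rows and columns of the type mat are numbered from 0, whereas elements of Delta n are
   pairs of indices in {1..n}; hence the shifts by 1 below. *)
definition elem_mat :: "nat \<Rightarrow> nat \<Rightarrow> nat \<Rightarrow> 'a::field \<Rightarrow> 'a mat" where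
  "elem_mat n i j t = addrow_mat n t (i - 1) (j - 1)"

definition unitriangular :: "nat \<Rightarrow> 'a::field mat set" where
  "unitriangular n = {g \<in> carrier_mat n n. upper_triangular g \<and> (\<forall>i<n. g $$ (i, i) = 1)}"

definition pattern_group :: "nat \<Rightarrow> (nat \<times> nat) set \<Rightarrow> 'a::field mat monoid" where
  "pattern_group n R =
     \<lparr>carrier = {g \<in> unitriangular n. \<forall>(i, j) \<in> Delta n - R. g $$ (i - 1, j - 1) = 0},
      monoid.mult = (*), one = 1\<^sub>m n\<rparr>"

definition root_gens :: "nat \<Rightarrow> 'a::field set \<Rightarrow> nat \<times> nat \<Rightarrow> 'a mat set" where
  "root_gens n T = (\<lambda>(i, j). {elem_mat n i j t | t. t \<in> T})"

(* The subgroup of U generated by the elements e_{k,l}(t) with t in T and (k,l) in A. *)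
definition gen_by :: "nat \<Rightarrow> 'a::field set \<Rightarrow> (nat \<times> nat) set \<Rightarrow> (nat \<times> nat) set \<Rightarrow> 'a mat set" where
  "gen_by n T R A = generate (pattern_group n R) (\<Union>x\<in>A. root_gens n T x)"

definition parabolic :: "nat \<Rightarrow> 'a::field set \<Rightarrow> (nat \<times> nat) set \<Rightarrow> (nat \<times> nat) set \<Rightarrow> 'a mat set" where
  "parabolic n T R K =
     (if K = {} then carrier (pattern_group n R)
      else (\<Inter>x\<in>K. gen_by n T R (covers R - {x})))"

definition borel_subgroup :: "nat \<Rightarrow> 'a::field set \<Rightarrow> (nat \<times> nat) set \<Rightarrow> 'a mat set" where
  "borel_subgroup n T R = parabolic n T R (covers R)"

(* The first three conjuncts say that the union of the family S is a finite generating set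
   of G and that the family partitions it. *)
definition intersection_property :: "('g, 'b) monoid_scheme \<Rightarrow> 'i set \<Rightarrow> ('i \<Rightarrow> 'g set) \<Rightarrow> bool" where
  "intersection_property G I S \<longleftrightarrow>
     finite (\<Union>i\<in>I. S i) \<and>
     generate G (\<Union>i\<in>I. S i) = carrier G \<and>
     disjoint_family_on S I \<and>
     (\<forall>J K. J \<subseteq> I \<longrightarrow> K \<subseteq> I \<longrightarrow>
        generate G (\<Union>j\<in>J. S j) \<inter> generate G (\<Union>j\<in>K. S j) = generate G (\<Union>j\<in>J \<inter> K. S j))"

end

theory Submission
  imports Defs
begin

text \<open>
  For \<open>A \<subseteq> R\<close> with \<open>R\<close> closed, the subgroup generated by the matrices \<open>e_{i,j}(t)\<close> with
  \<open>t \<in> T\<close> and \<open>(i,j) \<in> A\<close> is again a pattern group, namely the one of the transitive closure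
  \<open>A\<^sup>+\<close> (lemma \<open>gen_by_eq_pattern_group\<close>). One inclusion holds because that pattern group
  contains the generators. For the other, \<open>T\<close> spans the field additively and
  \<open>[e_{i,k}(s), e_{k,j}(1)] = e_{i,j}(s)\<close>, so that all \<open>e_{i,j}(s)\<close> with \<open>(i,j) \<in> A\<^sup>+\<close> are
  generated; and row reduction from the bottom up writes every element of a pattern group as a
  product of such matrices.

  A pattern group determines its pattern, and intersecting pattern groups means intersecting
  patterns. Hence, with \<open>I\<close> the set of covers, all four conditions only concern the transitive
  closures of subsets of \<open>I\<close>, and the equivalence is proved in a circle.
  The intersection property gives the formula for \<open>U_K\<close> by induction on \<open>K\<close>, and \<open>K = I\<close>
  in that formula gives a trivial Borel subgroup.
  If \<open>B\<close> is trivial, then for each \<open>(i,j)\<close> in the order some cover \<open>(a,b)\<close> satisfies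
  \<open>(i,j) \<notin> (I - {(a,b)})\<^sup>+\<close>, which means that every \<open>(i,j)\<close>-chain runs through \<open>(a,b)\<close>.
  Such a chain consists of an \<open>(i,a)\<close>-chain and a \<open>(b,j)\<close>-chain, and both are unique by
  induction on \<open>j - i\<close> (lemma \<open>chains_unique_if_unavoidable_covers\<close>).
  Finally, if chains are unique and \<open>(i,j)\<close> lies in \<open>J\<^sup>+ \<inter> K\<^sup>+\<close>, then a chain with steps in
  \<open>J\<close> and one with steps in \<open>K\<close> coincide, so \<open>(i,j) \<in> (J \<inter> K)\<^sup>+\<close>.
\<close>

section \<open>Pattern groups and elementary matrices\<close>

lemma finite_Delta: "finite (Delta n)"
  by (rule finite_subset[of _ "{..n} \<times> {..n}"]) (auto simp: Delta_def)

lemma trans_Delta: "trans (Delta n)"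
  by (auto simp: trans_def Delta_def)

lemma subset_DeltaD: "R \<subseteq> Delta n \<Longrightarrow> (i, j) \<in> R \<Longrightarrow> 1 \<le> i \<and> i < j \<and> j \<le> n"
  by (auto simp: Delta_def)

lemma pattern_group_simps [simp]:
  "monoid.mult (pattern_group n R) = (*)" "one (pattern_group n R) = 1\<^sub>m n"
  by (simp_all add: pattern_group_def)

text \<open>Since \<open>R\<close> lies above the diagonal, vanishing outside \<open>R\<close> already includes
  upper triangularity, so that the two vanishing conditions merge into one.\<close>

lemma carrier_pattern_group_iff:
  assumes "R \<subseteq> Delta n"
  shows "g \<in> carrier (pattern_group n R) \<longleftrightarrow>
    g \<in> carrier_mat n n \<and> (\<forall>a<n. g $$ (a, a) = 1) \<and>
    (\<forall>a<n. \<forall>b<n. a \<noteq> b \<longrightarrow> (Suc a, Suc b) \<notin> R \<longrightarrow> g $$ (a, b) = 0)" (is "_ \<longleftrightarrow> ?r")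
proof
  assume g: "g \<in> carrier (pattern_group n R)"
  have "g $$ (a, b) = 0" if "a < n" "b < n" "a \<noteq> b" "(Suc a, Suc b) \<notin> R" for a b
  proof (cases "a < b")
    case True
    then have "(Suc a, Suc b) \<in> Delta n - R"
      using that by (auto simp: Delta_def)
    then show ?thesis using g by (force simp: pattern_group_def)
  next
    case False
    then show ?thesis
      using g that by (auto simp: pattern_group_def unitriangular_def upper_triangular_def)
  qed
  then show ?r using g by (auto simp: pattern_group_def unitriangular_def)
next
  assume r: ?r
  have "upper_triangular g"
  proof (rule upper_triangularI)
    fix a b assume "b < a" "a < dim_row g"
    moreover from \<open>b < a\<close> have "(Suc a, Suc b) \<notin> R" using subset_DeltaD[OF assms] by force
    ultimately show "g $$ (a, b) = 0" using r by auto
  qed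
  moreover have "g $$ (i - 1, j - 1) = 0" if "(i, j) \<in> Delta n - R" for i j
  proof -
    have "Suc (i - 1) = i" "Suc (j - 1) = j" "i - 1 < n" "j - 1 < n" "i - 1 \<noteq> j - 1"
      using that by (auto simp: Delta_def)
    then show ?thesis using r that by (metis (no_types) DiffD2)
  qed
  ultimately show "g \<in> carrier (pattern_group n R)"
    using r by (auto simp: pattern_group_def unitriangular_def)
qed

lemma pattern_group_carrier_mat: "g \<in> carrier (pattern_group n R) \<Longrightarrow> g \<in> carrier_mat n n"
  by (auto simp: pattern_group_def unitriangular_def)

lemma one_in_pattern_group: "R \<subseteq> Delta n \<Longrightarrow> 1\<^sub>m n \<in> carrier (pattern_group n R)"
  by (auto simp: carrier_pattern_group_iff)

lemma pattern_group_mult_closed: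
  fixes g h :: "'a::field mat"
  assumes R: "R \<subseteq> Delta n" "trans R"
    and g: "g \<in> carrier (pattern_group n R)" and h: "h \<in> carrier (pattern_group n R)"
  shows "g * h \<in> carrier (pattern_group n R)"
proof -
  note iff = carrier_pattern_group_iff[OF R(1)]
  have gh: "g \<in> carrier_mat n n" "h \<in> carrier_mat n n" using g h by (auto simp: iff)
  have entry: "(g * h) $$ (a, b) = (\<Sum>k<n. g $$ (a, k) * h $$ (k, b))" if "a < n" "b < n" for a b
    using gh that by (auto simp: scalar_prod_def lessThan_atLeast0 intro!: sum.cong)
  have "(g * h) $$ (a, a) = 1" if a: "a < n" for a
  proof -
    have "g $$ (a, k) * h $$ (k, a) = (if k = a then 1 else 0)" if k: "k < n" for k
    proof (cases "k = a")
      case False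
      have "(Suc a, Suc k) \<notin> R \<or> (Suc k, Suc a) \<notin> R"
        using subset_DeltaD[OF R(1)] by (meson less_asym)
      then show ?thesis using False a k g h by (auto simp: iff)
    qed (use a g h in \<open>auto simp: iff\<close>)
    then have "(\<Sum>k<n. g $$ (a, k) * h $$ (k, a)) = (\<Sum>k<n. if k = a then 1 else 0)"
      by (intro sum.cong) auto
    then show ?thesis using a by (simp add: entry)
  qed
  moreover have "(g * h) $$ (a, b) = 0"
    if ab: "a < n" "b < n" "a \<noteq> b" "(Suc a, Suc b) \<notin> R" for a b
  proof -
    have "g $$ (a, k) * h $$ (k, b) = 0" if k: "k < n" for k
    proof (cases "k = a \<or> k = b")
      case True
      then show ?thesis using ab g h by (auto simp: iff)
    next
      case False
      have "(Suc a, Suc k) \<notin> R \<or> (Suc k, Suc b) \<notin> R"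
        using ab(4) R(2) by (meson transD)
      then show ?thesis using False ab k g h by (auto simp: iff)
    qed
    then have "(\<Sum>k<n. g $$ (a, k) * h $$ (k, b)) = 0" by (intro sum.neutral) blast
    then show ?thesis using ab by (simp add: entry)
  qed
  ultimately show ?thesis using gh by (auto simp: iff)
qed

lemma elem_mat_carrier [simp]: "elem_mat n i j s \<in> carrier_mat n n"
  by (simp add: elem_mat_def)

lemma elem_mat_mult_carrier [simp]:
  "A \<in> carrier_mat n n \<Longrightarrow> elem_mat n i j s * A \<in> carrier_mat n n"
  by (rule mult_carrier_mat[OF elem_mat_carrier])

lemma index_elem_mat:
  assumes "(i, j) \<in> Delta n" "a < n" "b < n"
  shows "elem_mat n i j s $$ (a, b) =
    (if a = b then 1 else if Suc a = i \<and> Suc b = j then s else 0)"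
  using assms by (auto simp: elem_mat_def Delta_def)

lemma index_elem_mat_mult:
  assumes "(i, j) \<in> Delta n" "A \<in> carrier_mat n n" "a < n" "b < n"
  shows "(elem_mat n i j s * A) $$ (a, b) =
    (if Suc a = i then s * A $$ (j - 1, b) + A $$ (a, b) else A $$ (a, b))"
proof -
  have "elem_mat n i j s * A = addrow s (i - 1) (j - 1) A"
    unfolding elem_mat_def
    by (rule addrow_mat[symmetric, OF assms(2)]) (use assms in \<open>auto simp: Delta_def\<close>)
  then show ?thesis using assms by (auto simp: Delta_def)
qed

lemma elem_mat_in_pattern_group_iff:
  assumes "R \<subseteq> Delta n" "(i, j) \<in> Delta n"
  shows "elem_mat n i j s \<in> carrier (pattern_group n R) \<longleftrightarrow> (i, j) \<in> R \<or> s = 0"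
proof -
  have ij: "Suc (i - 1) = i" "Suc (j - 1) = j" "i - 1 < n" "j - 1 < n" "i - 1 \<noteq> j - 1"
    using assms(2) by (auto simp: Delta_def)
  have "s = 0" if "elem_mat n i j s \<in> carrier (pattern_group n R)" "(i, j) \<notin> R"
  proof -
    have "elem_mat n i j s $$ (i - 1, j - 1) = 0"
      using that ij unfolding carrier_pattern_group_iff[OF assms(1)] by simp
    then show ?thesis using ij by (simp add: index_elem_mat[OF assms(2)])
  qed
  moreover have "elem_mat n i j s \<in> carrier (pattern_group n R)" if "(i, j) \<in> R \<or> s = 0"
    unfolding carrier_pattern_group_iff[OF assms(1)]
  proof (intro conjI allI impI)
    fix a b assume ab: "a < n" "b < n" "a \<noteq> b" "(Suc a, Suc b) \<notin> R"
    then show "elem_mat n i j s $$ (a, b) = 0"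
      using that by (cases "Suc a = i \<and> Suc b = j") (auto simp: index_elem_mat[OF assms(2)])
  qed (simp_all add: index_elem_mat[OF assms(2)])
  ultimately show ?thesis by blast
qed

lemma elem_mat_0: "(i, j) \<in> Delta n \<Longrightarrow> elem_mat n i j 0 = 1\<^sub>m n"
  by (rule eq_matI) (auto simp: index_elem_mat elem_mat_def)

lemma elem_mat_inject:
  assumes "(i, j) \<in> Delta n" "(k, l) \<in> Delta n" "s \<noteq> 0"
  shows "elem_mat n i j s = elem_mat n k l t \<longleftrightarrow> (i, j) = (k, l) \<and> s = t"
proof
  assume eq: "elem_mat n i j s = elem_mat n k l t"
  have "elem_mat n i j s $$ (i - 1, j - 1) = elem_mat n k l t $$ (i - 1, j - 1)"
    by (simp add: eq)
  then show "(i, j) = (k, l) \<and> s = t"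
    using assms by (auto simp: index_elem_mat Delta_def split: if_splits)
qed auto

lemma elem_mat_add:
  assumes "(i, j) \<in> Delta n"
  shows "elem_mat n i j s * elem_mat n i j t = elem_mat n i j (s + t)"
proof (rule eq_matI)
  fix a b assume "a < dim_row (elem_mat n i j (s + t))" "b < dim_col (elem_mat n i j (s + t))"
  then have "a < n" "b < n" by (auto simp: elem_mat_def)
  then show "(elem_mat n i j s * elem_mat n i j t) $$ (a, b) = elem_mat n i j (s + t) $$ (a, b)"
    using assms by (cases i; cases j)
      (auto simp: index_elem_mat_mult index_elem_mat Delta_def simp del: index_mult_mat(1))
qed (auto simp: elem_mat_def)

lemma elem_mat_cancel:
  assumes "(i, j) \<in> Delta n" "g \<in> carrier_mat n n"
  shows "elem_mat n i j (- s) * (elem_mat n i j s * g) = g"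
proof -
  have "elem_mat n i j (- s) * (elem_mat n i j s * g) = elem_mat n i j (- s) * elem_mat n i j s * g"
    by (rule assoc_mult_mat[of _ n n _ n _ n, symmetric]) (use assms in auto)
  then show ?thesis using assms by (simp add: elem_mat_add elem_mat_0)
qed

text \<open>The commutator relation \<open>[e_{i,k}(s), e_{k,j}(1)] = e_{i,j}(s)\<close>, written without inverses.\<close>

lemma elem_mat_commutator:
  assumes ik: "(i, k) \<in> Delta n" and kj: "(k, j) \<in> Delta n"
  shows "elem_mat n i k s * elem_mat n k j 1 =
    elem_mat n i j s * (elem_mat n k j 1 * elem_mat n i k s)"
proof -
  \<comment> \<open>As row operations on an arbitrary matrix, the two sides can be compared row by row.\<close>
  have "elem_mat n i k s * (elem_mat n k j 1 * A) =
      elem_mat n i j s * (elem_mat n k j 1 * (elem_mat n i k s * A))" (is "?l = ?r")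
    if A: "A \<in> carrier_mat n n" for A
  proof (rule eq_matI)
    have ij: "(i, j) \<in> Delta n" using trans_Delta ik kj by (meson transD)
    have less: "1 \<le> i" "i < k" "k < j" "j \<le> n" using ik kj by (auto simp: Delta_def)
    fix a b assume "a < dim_row ?r" "b < dim_col ?r"
    then have ab: "a < n" "b < n" using A by (auto simp: elem_mat_def)
    have sub: "Suc (k - 1) = k" "Suc (j - 1) = j" "k - 1 < n" "j - 1 < n"
      using less by auto
    have neq: "k \<noteq> i" "j \<noteq> i" "j \<noteq> k" using less by auto
    note mult = index_elem_mat_mult[OF ik] index_elem_mat_mult[OF kj] index_elem_mat_mult[OF ij]
      elem_mat_mult_carrier
    have "?l $$ (a, b) = (if Suc a = i then s * (A $$ (j - 1, b) + A $$ (k - 1, b)) + A $$ (a, b)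
        else if Suc a = k then A $$ (j - 1, b) + A $$ (a, b) else A $$ (a, b))"
      using neq by (simp only: mult A ab sub if_True if_False refl mult_1_left split: if_split) simp
    moreover have "?r $$ (a, b) = (if Suc a = i then s * A $$ (j - 1, b) + (s * A $$ (k - 1, b) + A $$ (a, b))
        else if Suc a = k then A $$ (j - 1, b) + A $$ (a, b) else A $$ (a, b))"
      using neq by (simp only: mult A ab sub if_True if_False refl mult_1_left split: if_split) simp
    ultimately show "?l $$ (a, b) = ?r $$ (a, b)" by (simp add: algebra_simps)
  qed (use A in \<open>auto simp: elem_mat_def\<close>)
  from this[OF one_carrier_mat] show ?thesis
    by (simp add: right_mult_one_mat[OF elem_mat_carrier])
qed

text \<open>Row reduction. The last row \<open>i\<close> that differs from the identity matrix is treated first: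
  if its entry at \<open>j\<close> is nonzero, then row \<open>j > i\<close> is a unit row, so that multiplication by
  \<open>e_{i,j}(-g_{i,j})\<close> clears this entry and changes no other. Only positions in the support of \<open>g\<close> occur, so that
  every factor split off belongs to \<open>R\<close>.\<close>

lemma pattern_group_induct [consumes 2, case_names one mult]:
  fixes g :: "'a::field mat"
  assumes g: "g \<in> carrier (pattern_group n R)" and R: "R \<subseteq> Delta n"
    and one: "P (1\<^sub>m n)"
    and mult: "\<And>i j s g. (i, j) \<in> R \<Longrightarrow> g \<in> carrier (pattern_group n R) \<Longrightarrow> P g \<Longrightarrow>
      P (elem_mat n i j s * g)"
  shows "P g"
proof -
  note iff = carrier_pattern_group_iff[OF R]
  define supp where "supp g = {(a, b). a < n \<and> b < n \<and> a \<noteq> b \<and> g $$ (a, b) \<noteq> (0::'a)}" for g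
  have fin: "finite (supp g)" for g
    by (rule finite_subset[of _ "{..<n} \<times> {..<n}"]) (auto simp: supp_def)
  show ?thesis using g
  proof (induction "card (supp g)" arbitrary: g rule: less_induct)
    case less
    show ?case
    proof (cases "supp g = {}")
      case True
      have "g = 1\<^sub>m n"
        using less.prems True by (intro eq_matI) (auto simp: iff supp_def)
      then show ?thesis using one by simp
    next
      case False
      define a where "a = Max (fst ` supp g)"
      have "a \<in> fst ` supp g" unfolding a_def using False fin by (intro Max_in) auto
      then obtain b where ab: "(a, b) \<in> supp g" by force
      have max: "a' \<le> a" if "(a', b') \<in> supp g" for a' b'
        unfolding a_def using that fin by (intro Max_ge) force+
      have ab': "a < n" "b < n" "a \<noteq> b" "g $$ (a, b) \<noteq> 0" using ab by (auto simp: supp_def)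
      then have abR: "(Suc a, Suc b) \<in> R" using less.prems by (auto simp: iff)
      then have abD: "(Suc a, Suc b) \<in> Delta n" and "a < b" using R by (auto simp: Delta_def)
      have gc: "g \<in> carrier_mat n n" using less.prems by (auto simp: iff)
      have unit_row: "g $$ (b, c) = (if b = c then 1 else 0)" if "c < n" for c
      proof (cases "b = c")
        case False
        have "(b, c) \<notin> supp g" using max[of b c] \<open>a < b\<close> by auto
        then show ?thesis using False that ab' by (auto simp: supp_def)
      qed (use ab' less.prems in \<open>auto simp: iff\<close>)
      define h where "h = elem_mat n (Suc a) (Suc b) (- (g $$ (a, b))) * g"
      have hc: "h \<in> carrier_mat n n" using gc by (auto simp: h_def elem_mat_def)
      have h: "h $$ (x, y) = (if x = a \<and> y = b then 0 else g $$ (x, y))"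
        if "x < n" "y < n" for x y
        using that ab' gc abD unit_row by (simp add: h_def index_elem_mat_mult)
      have hR: "h \<in> carrier (pattern_group n R)"
        using less.prems hc h ab' by (auto simp: iff)
      have "supp h = supp g - {(a, b)}" using h by (auto simp: supp_def split: if_splits)
      then have "card (supp h) < card (supp g)" using ab fin by (metis card_Diff1_less)
      then have "P h" using less.hyps hR by blast
      then have "P (elem_mat n (Suc a) (Suc b) (g $$ (a, b)) * h)"
        by (rule mult[OF abR hR])
      also have "elem_mat n (Suc a) (Suc b) (g $$ (a, b)) * h = g"
        using elem_mat_cancel[OF abD gc, of "- (g $$ (a, b))"] by (simp add: h_def)
      finally show ?thesis .
    qed
  qed
qed

text \<open>Left inverses are built along the factorization into matrices \<open>e_{i,j}(s)\<close>, whose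
  inverses \<open>e_{i,j}(-s)\<close> have the same pattern.\<close>

lemma group_pattern_group:
  assumes R: "R \<subseteq> Delta n" "trans R"
  shows "group (pattern_group n R :: 'a::field mat monoid)"
proof (rule groupI; simp?)
  fix g h k :: "'a mat"
  assume g: "g \<in> carrier (pattern_group n R)"
  show "\<exists>h \<in> carrier (pattern_group n R). h * g = 1\<^sub>m n"
    using g R(1)
  proof (induction rule: pattern_group_induct)
    case one
    then show ?case using one_in_pattern_group[OF R(1)] by (metis one_carrier_mat right_mult_one_mat)
  next
    case (mult i j s g)
    then obtain h where h: "h \<in> carrier (pattern_group n R)" "h * g = 1\<^sub>m n" by blast
    have ij: "(i, j) \<in> Delta n" using mult R by auto
    have c: "h \<in> carrier_mat n n" "g \<in> carrier_mat n n"
      using h mult pattern_group_carrier_mat by auto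
    have "h * elem_mat n i j (- s) * (elem_mat n i j s * g) =
        h * (elem_mat n i j (- s) * (elem_mat n i j s * g))"
      by (rule assoc_mult_mat[of _ n n _ n _ n]) (use c in auto)
    also have "\<dots> = 1\<^sub>m n" using c h ij by (simp add: elem_mat_cancel)
    finally show ?case
      using pattern_group_mult_closed[OF R h(1)] mult(1) R ij
      by (metis elem_mat_in_pattern_group_iff)
  qed
  show "g * h \<in> carrier (pattern_group n R)" if "h \<in> carrier (pattern_group n R)"
    using pattern_group_mult_closed[OF R g that] .
  show "g * h * k = g * (h * k)"
    if "h \<in> carrier (pattern_group n R)" "k \<in> carrier (pattern_group n R)"
    using g that by (meson assoc_mult_mat pattern_group_carrier_mat)
  show "1\<^sub>m n * g = g" using g pattern_group_carrier_mat left_mult_one_mat by blast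
qed (use one_in_pattern_group[OF R(1)] in simp)

lemma subgroup_pattern_group:
  assumes R: "R \<subseteq> Delta n" "trans R" and Q: "Q \<subseteq> R" "trans Q"
  shows "subgroup (carrier (pattern_group n Q)) (pattern_group n R :: 'a::field mat monoid)"
proof -
  have QD: "Q \<subseteq> Delta n" using Q R by auto
  interpret R: group "pattern_group n R :: 'a mat monoid" by (rule group_pattern_group[OF R])
  interpret Q: group "pattern_group n Q :: 'a mat monoid" by (rule group_pattern_group[OF QD Q(2)])
  have sub: "carrier (pattern_group n Q) \<subseteq> (carrier (pattern_group n R) :: 'a mat set)"
    unfolding subset_iff carrier_pattern_group_iff[OF R(1)] carrier_pattern_group_iff[OF QD]
    using Q(1) by blast
  show ?thesis
  proof (rule R.subgroupI)
    fix g :: "'a mat" assume g: "g \<in> carrier (pattern_group n Q)"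
    have "inv\<^bsub>pattern_group n R\<^esub> g = inv\<^bsub>pattern_group n Q\<^esub> g"
      using Q.l_inv[OF g] g Q.inv_closed[OF g] sub by (intro R.inv_equality) auto
    then show "inv\<^bsub>pattern_group n R\<^esub> g \<in> carrier (pattern_group n Q)"
      using Q.inv_closed[OF g] by simp
  qed (use sub Q.m_closed Q.one_closed in auto)
qed

section \<open>Subgroups generated by root elements\<close>

lemma trancl_subset_closed: "A \<subseteq> R \<Longrightarrow> trans R \<Longrightarrow> A\<^sup>+ \<subseteq> R"
  by (metis trancl_id trancl_mono_subset)

text \<open>Scalars from the prime subfield act as integer multiples, so a basis over it generates
  the additive group of the field.\<close>

lemma prime_subfield_basis_induct [consumes 1, case_names gen zero minus add]:
  fixes T :: "'a::{field,finite} set"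
  assumes T: "basis_over prime_subfield T"
    and gen: "\<And>t. t \<in> T \<Longrightarrow> P t" and zero: "P 0" and minus: "\<And>s. P s \<Longrightarrow> P (- s)"
    and add: "\<And>s t. P s \<Longrightarrow> P t \<Longrightarrow> P (s + t)"
  shows "P s"
proof -
  have nat: "P (of_nat k * t)" if "P t" for k t
    by (induction k) (use that zero add in \<open>auto simp: distrib_right\<close>)
  have int: "P (of_int k * t)" if "P t" for k t
  proof (cases k rule: int_cases2)
    case (nonneg m)
    then show ?thesis using nat[OF that] by simp
  next
    case (nonpos m)
    then show ?thesis using minus[OF nat[OF that]] by simp
  qed
  obtain c where c: "c \<in> T \<rightarrow> prime_subfield" "s = (\<Sum>t\<in>T. c t * t)"
    using T unfolding basis_over_def by blast
  have "P (\<Sum>t\<in>X. c t * t)" if "X \<subseteq> T" for X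
  proof -
    have "finite X" by simp
    then show ?thesis using that
    proof (induction X)
      case (insert t X)
      then have "c t \<in> prime_subfield" using c by auto
      then have "P (c t * t)" using int[OF gen] insert by (auto simp: prime_subfield_def)
      then show ?case using insert add by auto
    qed (use zero in simp)
  qed
  then show ?thesis using c by simp
qed

lemma zero_notin_basis:
  fixes T :: "'a::{field,finite} set"
  assumes "basis_over prime_subfield T"
  shows "0 \<notin> T"
proof
  assume 0: "0 \<in> T"
  \<comment> \<open>The coefficient 1 at the vector 0 gives a nontrivial linear relation.\<close>
  define c :: "'a \<Rightarrow> 'a" where "c t = (if t = 0 then 1 else 0)" for t
  have "(1::'a) \<in> prime_subfield" "(0::'a) \<in> prime_subfield"
    unfolding prime_subfield_def by (metis of_int_1 rangeI, metis of_int_0 rangeI)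
  then have "c \<in> T \<rightarrow> prime_subfield" by (auto simp: c_def)
  moreover have "(\<Sum>t\<in>T. c t * t) = 0" by (auto simp: c_def intro!: sum.neutral)
  ultimately have "c 0 = 0" using assms 0 unfolding basis_over_def by blast
  then show False by (simp add: c_def)
qed

text \<open>This turns statements about generated subgroups of \<open>U\<close> into statements about relations.\<close>

lemma gen_by_eq_pattern_group:
  fixes T :: "'a::{field,finite} set"
  assumes T: "basis_over prime_subfield T" and R: "R \<subseteq> Delta n" "trans R" and A: "A \<subseteq> R"
  shows "gen_by n T R A = carrier (pattern_group n (A\<^sup>+))"
proof
  interpret R: group "pattern_group n R :: 'a mat monoid" by (rule group_pattern_group[OF R])
  have AR: "A\<^sup>+ \<subseteq> R" using A R(2) by (rule trancl_subset_closed)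
  have AD: "A\<^sup>+ \<subseteq> Delta n" using AR R by auto
  have gens: "(\<Union>x\<in>A. root_gens n T x) \<subseteq> carrier (pattern_group n (A\<^sup>+))"
  proof -
    have "elem_mat n i j t \<in> carrier (pattern_group n (A\<^sup>+))" if "(i, j) \<in> A" for i j and t :: 'a
      using that AD elem_mat_in_pattern_group_iff[OF AD] by blast
    then show ?thesis by (auto simp: root_gens_def)
  qed
  note sub = subgroup_pattern_group[OF R AR trans_trancl]
  show "gen_by n T R A \<subseteq> carrier (pattern_group n (A\<^sup>+))"
    unfolding gen_by_def by (rule R.generate_subgroup_incl[OF gens sub])
  have "(\<Union>x\<in>A. root_gens n T x) \<subseteq> carrier (pattern_group n R)"
    using gens subgroup.subset[OF sub] by blast
  then have "subgroup (gen_by n T R A) (pattern_group n R)"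
    unfolding gen_by_def by (rule R.generate_is_subgroup)
  then interpret H: subgroup "gen_by n T R A" "pattern_group n R" .
  have closed: "g * h \<in> gen_by n T R A" if "g \<in> gen_by n T R A" "h \<in> gen_by n T R A" for g h
    using H.m_closed[OF that] by simp
  have cancel: "g \<in> gen_by n T R A"
    if gh: "g * h \<in> gen_by n T R A" and h: "h \<in> gen_by n T R A"
      and g: "g \<in> carrier (pattern_group n R)" for g h
  proof -
    have "(g \<otimes>\<^bsub>pattern_group n R\<^esub> h) \<otimes>\<^bsub>pattern_group n R\<^esub> inv\<^bsub>pattern_group n R\<^esub> h = g"
      using g h by (meson H.mem_carrier R.inv_solve_right' R.m_closed)
    then show ?thesis using H.m_closed[OF _ H.m_inv_closed[OF h], of "g * h"] gh by simp
  qed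
  have elem_R: "elem_mat n i j s \<in> carrier (pattern_group n R)" if "(i, j) \<in> R" for i j and s :: 'a
    using that elem_mat_in_pattern_group_iff[OF R(1)] R(1) by blast
  have base: "elem_mat n i j s \<in> gen_by n T R A" if ij: "(i, j) \<in> A" for i j and s :: 'a
  proof -
    have D: "(i, j) \<in> Delta n" using ij A R by auto
    show ?thesis
      using T
    proof (induction s rule: prime_subfield_basis_induct)
      case (gen t)
      then show ?case
        unfolding gen_by_def using ij
        by (intro generate.incl) (force simp: root_gens_def)
    next
      case zero
      then show ?case using H.one_closed by (simp add: elem_mat_0[OF D])
    next
      case (minus s)
      then show ?case
        using cancel[of "elem_mat n i j (- s)" "elem_mat n i j s"] H.one_closed elem_R ij A
        by (auto simp: elem_mat_add[OF D] elem_mat_0[OF D])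
    next
      case (add s t)
      then show ?case using closed[OF add.IH] by (simp add: elem_mat_add[OF D])
    qed
  qed
  have elem: "elem_mat n i j s \<in> gen_by n T R A" if "(i, j) \<in> A\<^sup>+" for i j and s :: 'a
    using that
  proof (induction rule: trancl_induct)
    case (step k j)
    have D: "(i, k) \<in> Delta n" "(k, j) \<in> Delta n" and ij: "(i, j) \<in> R"
      using step A AD AR trancl_into_trancl[of i k A j] by auto
    have "elem_mat n i j s * (elem_mat n k j 1 * elem_mat n i k s) \<in> gen_by n T R A"
      using closed[OF step.IH base[OF step(2), of 1]] by (simp add: elem_mat_commutator[OF D])
    then show ?case
      using cancel closed[OF base[OF step(2)] step.IH] elem_R[OF ij] by blast
  qed (rule base)
  show "carrier (pattern_group n (A\<^sup>+)) \<subseteq> gen_by n T R A"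
  proof
    fix g :: "'a mat" assume "g \<in> carrier (pattern_group n (A\<^sup>+))"
    then show "g \<in> gen_by n T R A" using AD
    proof (induction rule: pattern_group_induct)
      case one
      then show ?case using H.one_closed by simp
    next
      case (mult i j s g)
      then show ?case using closed elem by blast
    qed
  qed
qed

lemma carrier_pattern_group_Int:
  assumes "Q \<subseteq> Delta n" "R \<subseteq> Delta n"
  shows "carrier (pattern_group n Q) \<inter> carrier (pattern_group n R) =
    carrier (pattern_group n (Q \<inter> R))"
proof -
  have "Q \<inter> R \<subseteq> Delta n" using assms by auto
  then show ?thesis
    by (auto simp: carrier_pattern_group_iff[OF assms(1)] carrier_pattern_group_iff[OF assms(2)]
        carrier_pattern_group_iff)
qed

lemma carrier_pattern_group_empty: "carrier (pattern_group n {}) = {1\<^sub>m n}"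
  by (auto simp: carrier_pattern_group_iff intro!: eq_matI)

text \<open>The hypothesis covers \<open>K = {}\<close>, where the parabolic subgroup is all of \<open>U\<close> by
  convention.\<close>

lemma parabolic_insert:
  assumes "gen_by n T R (covers R - {x}) \<subseteq> carrier (pattern_group n R)"
  shows "parabolic n T R (insert x K) = gen_by n T R (covers R - {x}) \<inter> parabolic n T R K"
  using assms by (auto simp: parabolic_def)

section \<open>Chains of covers\<close>

lemma covers_subset: "covers R \<subseteq> R"
  by (auto simp: covers_def)

lemma covers_trancl:
  assumes R: "R \<subseteq> Delta n" "trans R"
  shows "(covers R)\<^sup>+ = R"
proof
  show "(covers R)\<^sup>+ \<subseteq> R" using covers_subset R(2) by (rule trancl_subset_closed)
  have "(i, j) \<in> (covers R)\<^sup>+" if "(i, j) \<in> R" for i j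
    using that
  proof (induction "j - i" arbitrary: i j rule: less_induct)
    case less
    show ?case
    proof (cases "(i, j) \<in> covers R")
      case False
      then obtain k where k: "(i, k) \<in> R" "(k, j) \<in> R" using less.prems by (auto simp: covers_def)
      then have "i < k" "k < j" using subset_DeltaD[OF R(1)] by blast+
      then have "(i, k) \<in> (covers R)\<^sup>+" "(k, j) \<in> (covers R)\<^sup>+"
        using less.hyps k by simp_all
      then show ?thesis by (rule trancl_trans)
    qed auto
  qed
  then show "R \<subseteq> (covers R)\<^sup>+" by auto
qed

text \<open>Chains for an arbitrary step relation, in order to compare chains with steps in different
  sets of covers. The one-element list is a chain from its element to itself.\<close>

definition rel_chains :: "('b \<times> 'b) set \<Rightarrow> 'b \<Rightarrow> 'b \<Rightarrow> 'b list set" where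
  "rel_chains A i j =
    {c. c \<noteq> [] \<and> successively (\<lambda>a b. (a, b) \<in> A) c \<and> hd c = i \<and> last c = j}"

lemma rel_chains_mono: "A \<subseteq> B \<Longrightarrow> rel_chains A i j \<subseteq> rel_chains B i j"
  unfolding rel_chains_def by (auto elim: successively_mono)

lemma rtrancl_iff_rel_chains: "(i, j) \<in> A\<^sup>* \<longleftrightarrow> rel_chains A i j \<noteq> {}"
proof
  show "rel_chains A i j \<noteq> {}" if "(i, j) \<in> A\<^sup>*"
    using that
  proof (induction rule: converse_rtrancl_induct)
    case base
    have "[j] \<in> rel_chains A j j" by (simp add: rel_chains_def)
    then show ?case by blast
  next
    case (step i k)
    then obtain c where "c \<in> rel_chains A k j" by blast
    then have "i # c \<in> rel_chains A i j"
      using step by (auto simp: rel_chains_def successively_Cons)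
    then show ?case by blast
  qed
  have "(hd c, last c) \<in> A\<^sup>*" if "c \<noteq> []" "successively (\<lambda>a b. (a, b) \<in> A) c" for c
    using that by (induction c) (auto simp: successively_Cons intro: converse_rtrancl_into_rtrancl)
  then show "(i, j) \<in> A\<^sup>*" if "rel_chains A i j \<noteq> {}"
    using that by (auto simp: rel_chains_def)
qed

lemma trancl_iff_rel_chains:
  assumes "i \<noteq> j"
  shows "(i, j) \<in> A\<^sup>+ \<longleftrightarrow> rel_chains A i j \<noteq> {}"
  using assms by (simp add: rtrancl_iff_rel_chains[symmetric] rtrancl_eq_or_trancl)

lemma cover_chains_eq_rel_chains:
  assumes R: "R \<subseteq> Delta n" and i: "i \<in> {1..n}"
  shows "cover_chains n R i j = rel_chains (covers R) i j"
proof -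
  have "set c \<subseteq> {1..n}"
    if "c \<noteq> []" "successively (\<lambda>a b. (a, b) \<in> covers R) c" "hd c \<in> {1..n}" for c
    using that
  proof (induction c)
    case (Cons a c)
    have "(a, hd c) \<in> Delta n" if "c \<noteq> []"
      using Cons that R covers_subset by (auto simp: successively_Cons)
    then show ?case using Cons by (cases "c = []") (auto simp: Delta_def successively_Cons)
  qed simp
  then show ?thesis using i by (auto simp: cover_chains_def rel_chains_def)
qed

lemma successively_avoid_or_split:
  assumes "successively (\<lambda>a b. (a, b) \<in> A) c"
  shows "successively (\<lambda>a b. (a, b) \<in> A - {(x, y)}) c \<or> (\<exists>c1 c2. c = c1 @ x # y # c2)"
  using assms
proof (induction c)
  case (Cons a c)
  show ?case
  proof (cases "c \<noteq> [] \<and> (a, hd c) = (x, y)")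
    case True
    then have "a # c = [] @ x # y # tl c" by (cases c) auto
    then show ?thesis by blast
  next
    case False
    then show ?thesis using Cons by (auto simp: successively_Cons) (metis append_Cons)+
  qed
qed simp

text \<open>A cover that no \<open>(i,j)\<close>-chain avoids cuts every \<open>(i,j)\<close>-chain at the same place. The
  induction needs \<open>i = j\<close> as well, since the cover may start at \<open>i\<close> or end at \<open>j\<close>.\<close>

lemma chains_unique_if_unavoidable_covers:
  assumes A: "A \<subseteq> Delta n"
    and unavoidable: "\<And>i j. (i, j) \<in> A\<^sup>+ \<Longrightarrow> \<exists>x\<in>A. (i, j) \<notin> (A - {x})\<^sup>+"
    and c: "c \<in> rel_chains A i j" and c': "c' \<in> rel_chains A i j"
  shows "c = c'"
  using c c'
proof (induction "j - i" arbitrary: i j c c' rule: less_induct)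
  case less
  have le: "i \<le> j \<and> (i = j \<longrightarrow> c = [i])" if "c \<in> rel_chains A i j" for i j c
    using that
  proof (induction c arbitrary: i)
    case (Cons a c)
    show ?case
    proof (cases "c = []")
      case False
      then have "i < hd c" "c \<in> rel_chains A (hd c) j"
        using Cons.prems A by (auto simp: rel_chains_def successively_Cons Delta_def)
      then show ?thesis using Cons.IH[of "hd c"] by auto
    qed (use Cons in \<open>auto simp: rel_chains_def\<close>)
  qed (simp add: rel_chains_def)
  show ?case
  proof (cases "i = j")
    case True
    then show ?thesis using le less.prems by metis
  next
    case False
    then have "(i, j) \<in> A\<^sup>+" using less.prems(1) trancl_iff_rel_chains[OF False] by blast
    then obtain x y where xy: "(x, y) \<in> A" "(i, j) \<notin> (A - {(x, y)})\<^sup>+"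
      using unavoidable by (metis surj_pair)
    have "x < y" using xy A by (auto simp: Delta_def)
    have split: "\<exists>c1 c2. c = (c1 @ [x]) @ (y # c2) \<and>
        c1 @ [x] \<in> rel_chains A i x \<and> y # c2 \<in> rel_chains A y j"
      if c: "c \<in> rel_chains A i j" for c
    proof -
      have "c \<notin> rel_chains (A - {(x, y)}) i j"
        using xy(2) trancl_iff_rel_chains[OF False] by blast
      then obtain c1 c2 where c12: "c = c1 @ x # y # c2"
        using c successively_avoid_or_split[of A c x y] by (auto simp: rel_chains_def)
      have "hd (c1 @ [x]) = i" "successively (\<lambda>a b. (a, b) \<in> A) ((c1 @ [x]) @ (y # c2))"
        and "last (y # c2) = j"
        using c unfolding c12 rel_chains_def by (simp_all add: hd_append split: if_splits)
      then have "c1 @ [x] \<in> rel_chains A i x" "y # c2 \<in> rel_chains A y j"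
        by (simp_all add: rel_chains_def successively_append_iff)
      then show ?thesis using c12 by auto
    qed
    from split[OF less.prems(1)] obtain c1 c2 where 1: "c = (c1 @ [x]) @ (y # c2)"
      "c1 @ [x] \<in> rel_chains A i x" "y # c2 \<in> rel_chains A y j" by blast
    from split[OF less.prems(2)] obtain d1 d2 where 2: "c' = (d1 @ [x]) @ (y # d2)"
      "d1 @ [x] \<in> rel_chains A i x" "y # d2 \<in> rel_chains A y j" by blast
    have "i \<le> x" "y \<le> j" using le 1 by auto
    then have "x - i < j - i" "j - y < j - i" using \<open>x < y\<close> by auto
    then have "c1 @ [x] = d1 @ [x]" "y # c2 = y # d2"
      using less.hyps 1 2 by blast+
    then show ?thesis using 1 2 by simp
  qed
qed

lemma trancl_Int_if_chains_unique:
  assumes unique: "\<And>i j c d. (i, j) \<in> A\<^sup>+ \<Longrightarrow> c \<in> rel_chains A i j \<Longrightarrow> d \<in> rel_chains A i j \<Longrightarrow> c = d"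
    and A: "A \<subseteq> Delta n" and JK: "J \<subseteq> A" "K \<subseteq> A"
  shows "J\<^sup>+ \<inter> K\<^sup>+ = (J \<inter> K)\<^sup>+"
proof
  show "(J \<inter> K)\<^sup>+ \<subseteq> J\<^sup>+ \<inter> K\<^sup>+" by (simp add: trancl_mono_subset)
  show "J\<^sup>+ \<inter> K\<^sup>+ \<subseteq> (J \<inter> K)\<^sup>+"
  proof (rule subrelI)
    fix i j assume ij: "(i, j) \<in> J\<^sup>+ \<inter> K\<^sup>+"
    then have "(i, j) \<in> A\<^sup>+" using JK by (auto intro: trancl_mono)
    then have ne: "i \<noteq> j" using trancl_subset_closed[OF A trans_Delta] by (auto simp: Delta_def)
    have "rel_chains J i j \<noteq> {}" "rel_chains K i j \<noteq> {}"
      using ij by (simp_all add: trancl_iff_rel_chains[OF ne, symmetric])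
    then obtain c d where c: "c \<in> rel_chains J i j" and d: "d \<in> rel_chains K i j" by blast
    have "c \<in> rel_chains A i j" "d \<in> rel_chains A i j"
      using c d JK rel_chains_mono by (metis subsetD)+
    then have "c = d" using unique[OF \<open>(i, j) \<in> A\<^sup>+\<close>] by metis
    then have "c \<in> rel_chains (J \<inter> K) i j"
      using c d by (auto simp: rel_chains_def successively_conv_nth)
    then show "(i, j) \<in> (J \<inter> K)\<^sup>+" by (auto simp: trancl_iff_rel_chains[OF ne])
  qed
qed

section \<open>The equivalence\<close>

theorem proposition3p5:
  fixes n p m q :: nat
    and T :: "'a::{field,finite} set"
    and Ihat :: "(nat \<times> nat) set"
  assumes "n \<ge> 2"
    and "prime p" and "m \<ge> 1" and "q = p ^ m" and "card (UNIV :: 'a set) = q"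
    and "basis_over prime_subfield T"
    and "Ihat \<subseteq> Delta n" and "trans Ihat"
  shows
    "(intersection_property (pattern_group n Ihat :: 'a mat monoid) (covers Ihat) (root_gens n T)
        \<longleftrightarrow> (\<forall>K \<subseteq> covers Ihat. parabolic n T Ihat K = gen_by n T Ihat (covers Ihat - K)))
     \<and> ((\<forall>K \<subseteq> covers Ihat. parabolic n T Ihat K = gen_by n T Ihat (covers Ihat - K))
        \<longleftrightarrow> (\<forall>(i, j) \<in> Ihat. card (cover_chains n Ihat i j) = 1))
     \<and> ((\<forall>(i, j) \<in> Ihat. card (cover_chains n Ihat i j) = 1)
        \<longleftrightarrow> borel_subgroup n T Ihat = {1\<^sub>m n})"
proof -
  note T = assms(6) and R = assms(7,8)
  let ?I = "covers Ihat"
  let ?U = "\<lambda>R. carrier (pattern_group n R) :: 'a mat set"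
  have I: "?I \<subseteq> Delta n" using covers_subset R by blast
  have I_trancl: "?I\<^sup>+ = Ihat" using R by (rule covers_trancl)
  have finI: "finite ?I" using I finite_Delta finite_subset by blast
  have gen: "gen_by n T Ihat A = ?U (A\<^sup>+)" if "A \<subseteq> ?I" for A
    using that covers_subset by (intro gen_by_eq_pattern_group T R) blast
  have tr: "A\<^sup>+ \<subseteq> Ihat" if "A \<subseteq> ?I" for A
    using that covers_subset trancl_subset_closed R(2) by (metis subset_trans)
  then have trD: "A\<^sup>+ \<subseteq> Delta n" if "A \<subseteq> ?I" for A using that R(1) by blast
  have mono: "?U (A\<^sup>+) \<subseteq> ?U Ihat" if "A \<subseteq> ?I" for A
    using subgroup.subset[OF subgroup_pattern_group[OF R tr[OF that] trans_trancl]] .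
  have chains: "cover_chains n Ihat i j = rel_chains ?I i j" if "(i, j) \<in> Ihat" for i j
    using that R by (intro cover_chains_eq_rel_chains) (auto simp: Delta_def)

  have parabolic_formula: "\<forall>K \<subseteq> ?I. parabolic n T Ihat K = gen_by n T Ihat (?I - K)"
    if int: "intersection_property (pattern_group n Ihat :: 'a mat monoid) ?I (root_gens n T)"
  proof (intro allI impI)
    fix K assume "K \<subseteq> ?I"
    then have "finite K" using finI finite_subset by blast
    then show "parabolic n T Ihat K = gen_by n T Ihat (?I - K)" using \<open>K \<subseteq> ?I\<close>
    proof (induction K)
      case empty
      show ?case by (simp add: parabolic_def gen I_trancl)
    next
      case (insert x K)
      have "parabolic n T Ihat (insert x K) =
          gen_by n T Ihat (?I - {x}) \<inter> gen_by n T Ihat (?I - K)"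
        using insert mono[of "?I - {x}"] by (simp add: parabolic_insert gen)
      also have "\<dots> = gen_by n T Ihat ((?I - {x}) \<inter> (?I - K))"
        using int unfolding intersection_property_def gen_by_def by (meson Diff_subset)
      also have "(?I - {x}) \<inter> (?I - K) = ?I - insert x K" by auto
      finally show ?case .
    qed
  qed
  have borel_trivial: "borel_subgroup n T Ihat = {1\<^sub>m n}"
    if "\<forall>K \<subseteq> ?I. parabolic n T Ihat K = gen_by n T Ihat (?I - K)"
    using that by (simp add: borel_subgroup_def gen carrier_pattern_group_empty)
  have unique_chains: "\<forall>(i, j) \<in> Ihat. card (cover_chains n Ihat i j) = 1"
    if B: "borel_subgroup n T Ihat = {1\<^sub>m n}"
  proof -
    \<comment> \<open>Otherwise \<open>e_{i,j}(1)\<close> lies in all of the subgroups whose intersection is \<open>B\<close>.\<close>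
    have unavoidable: "\<exists>x\<in>?I. (i, j) \<notin> (?I - {x})\<^sup>+" if ij: "(i, j) \<in> Ihat" for i j
    proof (rule ccontr)
      assume neg: "\<not> ?thesis"
      have D: "(i, j) \<in> Delta n" using ij R by auto
      have "elem_mat n i j 1 \<in> ?U Ihat" using ij D R by (simp add: elem_mat_in_pattern_group_iff)
      moreover have "elem_mat n i j 1 \<in> ?U ((?I - {x})\<^sup>+)" if "x \<in> ?I" for x
        using neg D that trD[of "?I - {x}"] by (auto simp: elem_mat_in_pattern_group_iff)
      ultimately have "elem_mat n i j 1 \<in> borel_subgroup n T Ihat"
        by (auto simp: borel_subgroup_def parabolic_def gen)
      then have "elem_mat n i j (1::'a) = elem_mat n i j 0"
        using B by (simp add: elem_mat_0[OF D])
      then show False using elem_mat_inject[OF D D, of "1::'a" 0] by simp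
    qed
    have "card (cover_chains n Ihat i j) = 1" if ij: "(i, j) \<in> Ihat" for i j
    proof -
      have "i \<noteq> j" using ij R by (auto simp: Delta_def)
      then have "rel_chains ?I i j \<noteq> {}"
        using ij I_trancl trancl_iff_rel_chains[of i j ?I] by simp
      then obtain c where c: "c \<in> rel_chains ?I i j" by blast
      have "d = c" if "d \<in> rel_chains ?I i j" for d
        using chains_unique_if_unavoidable_covers[OF I _ that c] unavoidable I_trancl by simp
      then have "rel_chains ?I i j = {c}" using c by blast
      then show ?thesis using chains[OF ij] by simp
    qed
    then show ?thesis by auto
  qed
  have intersection: "intersection_property (pattern_group n Ihat :: 'a mat monoid) ?I (root_gens n T)"
    if card: "\<forall>(i, j) \<in> Ihat. card (cover_chains n Ihat i j) = 1"
    unfolding intersection_property_def gen_by_def[symmetric]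
  proof (intro conjI allI impI)
    have "finite (root_gens n T x)" for x
      by (auto simp: root_gens_def split: prod.splits)
    then show "finite (\<Union>x\<in>?I. root_gens n T x)" using finI by blast
    show "gen_by n T Ihat ?I = carrier (pattern_group n Ihat)" by (simp add: gen I_trancl)
    have "root_gens n T x \<inter> root_gens n T y = {}" if "x \<in> ?I" "y \<in> ?I" "x \<noteq> y" for x y
    proof -
      obtain i j k l where xy: "x = (i, j)" "y = (k, l)" by fastforce
      have "elem_mat n i j s \<noteq> elem_mat n k l t" if "s \<in> T" "t \<in> T" for s t
      proof -
        have "s \<noteq> 0" using that zero_notin_basis[OF T] by metis
        then show ?thesis using elem_mat_inject[of i j n k l s t] xy \<open>x \<in> ?I\<close> \<open>y \<in> ?I\<close> \<open>x \<noteq> y\<close> I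
          by auto
      qed
      then show ?thesis using xy by (auto simp: root_gens_def)
    qed
    then show "disjoint_family_on (root_gens n T) ?I" by (auto simp: disjoint_family_on_def)
    fix J K assume JK: "J \<subseteq> ?I" "K \<subseteq> ?I"
    have "c = d" if "(i, j) \<in> ?I\<^sup>+" "c \<in> rel_chains ?I i j" "d \<in> rel_chains ?I i j" for i j c d
      using that card chains I_trancl by (auto simp: card_1_singleton_iff)
    then have "J\<^sup>+ \<inter> K\<^sup>+ = (J \<inter> K)\<^sup>+" using I JK by (rule trancl_Int_if_chains_unique)
    moreover have "J \<inter> K \<subseteq> ?I" using JK by auto
    ultimately show "gen_by n T Ihat J \<inter> gen_by n T Ihat K = gen_by n T Ihat (J \<inter> K)"
      using JK by (simp add: gen carrier_pattern_group_Int trD)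
  qed
  show ?thesis using parabolic_formula borel_trivial unique_chains intersection by argo
qed

end
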